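(* There exists a heavy-tailed $K$-armed bandit instance in which the $(1+v)$-th moment of each reward distribution is bounded by $1$ (that is, $\mathbb E_{X\sim\mathcal X_a}[|X|^{1+v}]\le1$ for every arm $a$) such that, if $T$ is large enough, for any $\epsilon$-locally differentially private algorithm $\mathcal A$ with $\epsilon\in(0,1]$, the expected regret must satisfy $$\mathcal R_T\ge\Omega\left(\Bigl(\frac K{\epsilon^2}\Bigr)^{\frac v{1+v}}T^{\frac1{1+v}}\right).$$
   Context: Bandit setting. There are $K$ arms and $T$ rounds. Pulling arm $a$ generates an independent reward from a distribution $\mathcal X_a$ on $\mathbb R$ with mean $\mu_a$. In each round $t=1,\dots,T$ the learner pulls an arm $a_t\in[K]$ and a reward $x_t\sim\mathcal X_{a_t}$ is generated. With $\mu^*=\max_a\mu_a$, the expected regret is $\mathcal R_T=T\mu^*-\mathbb E[\sum_{t=1}^Tx_t]$. Here $v\in(0,1]$ is regarded as a known constant (for any constant $c$, $c^{1/v}$ is regarded as a constant), and $\Omega(\cdot)$ hides constant factors. Local differential privacy. A randomized map $\mathcal M:\mathcal X\to\mathcal Y$ is $\epsilon$-locally differentially private (LDP) if for all $x,x'\in\mathcal X$ and all measurable $O\subset\mathcal Y$, $\mathbb P[\mathcal M(x)\in O]\le e^\epsilon\,\mathbb P[\mathcal M(x')\in O]$. A bandit algorithm is $\epsilon$-LDP if each reward $x_t$ is perturbed by an $\epsilon$-LDP map before being collected, and the learner's decisions depend only on past arms, past perturbed rewards and internal randomness.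
   Formalization: Proved in minimax form: the instance may depend on the algorithm (for one fixed instance, always pulling its best arm has zero regret), with K ≥ 2 and "T large enough" depending on K and ε; the constants are chosen after the carrier sets of seeds and perturbed rewards. *)

theory Defs
  imports "HOL-Probability.Probability"
begin

text \<open>Arms are the numbers \<open>0, \<dots>, K - 1\<close> and rounds the numbers \<open>0, \<dots>, T - 1\<close>.\<close>


section \<open>Heavy-tailed bandit instances\<close>

definition arm_mean :: "real measure \<Rightarrow> real" where
  "arm_mean D = (\<integral>x. x \<partial>D)"

definition best_mean :: "nat \<Rightarrow> (nat \<Rightarrow> real measure) \<Rightarrow> real" where
  "best_mean K \<nu> = (MAX a\<in>{..<K}. arm_mean (\<nu> a))"

text \<open>The moment is taken as a nonnegative integral, so that the bound includes finiteness of the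
  moment (and hence, for \<open>v > 0\<close>, integrability of the rewards).\<close>

definition heavy_tailed_instance :: "nat \<Rightarrow> real \<Rightarrow> (nat \<Rightarrow> real measure) \<Rightarrow> bool" where
  "heavy_tailed_instance K v \<nu> \<longleftrightarrow>
    (\<forall>a<K. prob_space (\<nu> a) \<and> sets (\<nu> a) = sets borel \<and>
      (\<integral>\<^sup>+x. ennreal (\<bar>x\<bar> powr (1 + v)) \<partial>\<nu> a) \<le> 1)"


section \<open>Local differential privacy\<close>

text \<open>A randomized map from \<open>X\<close> to \<open>Y\<close> is a probability kernel.\<close>

definition locally_private ::
  "real \<Rightarrow> 'x measure \<Rightarrow> 'y measure \<Rightarrow> ('x \<Rightarrow> 'y measure) \<Rightarrow> bool" where
  "locally_private \<epsilon> X Y M \<longleftrightarrow>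
    M \<in> X \<rightarrow>\<^sub>M prob_algebra Y \<and>
    (\<forall>x\<in>space X. \<forall>x'\<in>space X. \<forall>S\<in>sets Y. measure (M x) S \<le> exp \<epsilon> * measure (M x') S)"


section \<open>Bandit algorithms acting on perturbed rewards\<close>

text \<open>
  A learner has a random seed of type \<open>'u\<close> (its internal randomness, drawn once before the first
  round; a seed may consist of independent components for the individual rounds) and receives
  perturbed rewards of type \<open>'y\<close>. In round \<open>t\<close> it sees the seed and the past pairs
  (arm, perturbed reward), given as a function on \<open>{..<t}\<close> that is \<open>undefined\<close> elsewhere.
  From these it computes \<open>pull\<close>, the next arm. The new reward reaches it only through the
  randomized map \<open>priv\<close>, which may be chosen depending on the same data and on the arm pulled.
\<close>

record ('u, 'y) bandit_algorithm =
  seed :: "'u measure"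
  outputs :: "'y measure"
  pull :: "nat \<Rightarrow> 'u \<Rightarrow> (nat \<Rightarrow> nat \<times> 'y) \<Rightarrow> nat"
  priv :: "nat \<Rightarrow> 'u \<Rightarrow> (nat \<Rightarrow> nat \<times> 'y) \<Rightarrow> nat \<Rightarrow> real \<Rightarrow> 'y measure"

definition view_space :: "nat \<Rightarrow> 'y measure \<Rightarrow> nat \<Rightarrow> (nat \<Rightarrow> nat \<times> 'y) measure" where
  "view_space K Y t = (\<Pi>\<^sub>M i\<in>{..<t}. count_space {..<K} \<Otimes>\<^sub>M Y)"

definition bandit_algorithm :: "nat \<Rightarrow> nat \<Rightarrow> ('u, 'y) bandit_algorithm \<Rightarrow> bool" where
  "bandit_algorithm K T A \<longleftrightarrow>
    prob_space (seed A) \<and>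
    (\<forall>t<T.
      (\<lambda>(u, h). pull A t u h) \<in> seed A \<Otimes>\<^sub>M view_space K (outputs A) t \<rightarrow>\<^sub>M count_space {..<K} \<and>
      (\<lambda>((u, h), a, x). priv A t u h a x)
        \<in> (seed A \<Otimes>\<^sub>M view_space K (outputs A) t) \<Otimes>\<^sub>M (count_space {..<K} \<Otimes>\<^sub>M borel)
          \<rightarrow>\<^sub>M prob_algebra (outputs A))"

definition ldp_algorithm :: "real \<Rightarrow> nat \<Rightarrow> nat \<Rightarrow> ('u, 'y) bandit_algorithm \<Rightarrow> bool" where
  "ldp_algorithm \<epsilon> K T A \<longleftrightarrow>
    bandit_algorithm K T A \<and>
    (\<forall>t<T. \<forall>u\<in>space (seed A). \<forall>h\<in>space (view_space K (outputs A) t). \<forall>a<K.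
      locally_private \<epsilon> borel (outputs A) (priv A t u h a))"


section \<open>Interaction and regret\<close>

text \<open>
  A run of length \<open>t\<close> is the seed together with the triples (arm, true reward, perturbed reward)
  of the rounds \<open>{..<t}\<close>.
\<close>

type_synonym ('u, 'y) run = "'u \<times> (nat \<Rightarrow> nat \<times> real \<times> 'y)"

definition run_space :: "nat \<Rightarrow> ('u, 'y) bandit_algorithm \<Rightarrow> nat \<Rightarrow> ('u, 'y) run measure" where
  "run_space K A t =
    seed A \<Otimes>\<^sub>M (\<Pi>\<^sub>M i\<in>{..<t}. count_space {..<K} \<Otimes>\<^sub>M (borel \<Otimes>\<^sub>M outputs A))"

definition view :: "nat \<Rightarrow> (nat \<Rightarrow> nat \<times> real \<times> 'y) \<Rightarrow> nat \<Rightarrow> nat \<times> 'y" where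
  "view t r = (\<lambda>i\<in>{..<t}. (fst (r i), snd (snd (r i))))"

definition extend_run ::
  "nat \<Rightarrow> (nat \<Rightarrow> real measure) \<Rightarrow> ('u, 'y) bandit_algorithm \<Rightarrow> nat \<Rightarrow> ('u, 'y) run
    \<Rightarrow> ('u, 'y) run measure" where
  "extend_run K \<nu> A t = (\<lambda>(u, r).
    let h = view t r; a = pull A t u h
    in \<nu> a \<bind> (\<lambda>x. priv A t u h a x \<bind>
         (\<lambda>y. return (run_space K A (Suc t)) (u, r(t := (a, x, y))))))"

primrec run_law ::
  "nat \<Rightarrow> (nat \<Rightarrow> real measure) \<Rightarrow> ('u, 'y) bandit_algorithm \<Rightarrow> nat \<Rightarrow> ('u, 'y) run measure" where
  "run_law K \<nu> A 0 = distr (seed A) (run_space K A 0) (\<lambda>u. (u, \<lambda>_. undefined))"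
| "run_law K \<nu> A (Suc t) = run_law K \<nu> A t \<bind> extend_run K \<nu> A t"

definition regret ::
  "nat \<Rightarrow> (nat \<Rightarrow> real measure) \<Rightarrow> nat \<Rightarrow> ('u, 'y) bandit_algorithm \<Rightarrow> real" where
  "regret K \<nu> T A =
    real T * best_mean K \<nu> - (\<integral>(u, r). (\<Sum>t<T. fst (snd (r t))) \<partial>run_law K \<nu> A T)"

end

theory Submission
  imports Defs
begin

text \<open>
  An arm is either the point mass at \<open>0\<close> or pays \<open>M = p\<^sup>-\<^sup>1\<^sup>/\<^sup>(\<^sup>1\<^sup>+\<^sup>v\<^sup>)\<close> with probability \<open>p\<close>, and exactly
  one arm \<open>j\<close> is of the second kind; its \<open>(1 + v)\<close>-th moment is \<open>1\<close> and its mean is the gap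
  \<open>M p\<close>. Behind an \<open>\<epsilon>\<close>-private map one round changes the law of what the learner sees by a
  chi-square distance of at most \<open>9 \<epsilon>\<^sup>2 p\<^sup>2\<close> compared with the instance in which no arm pays. With
  \<open>p = K / (T \<epsilon>\<^sup>2)\<close> this accumulates over \<open>T\<close> rounds to \<open>O(K\<^sup>2 / (T \<epsilon>\<^sup>2))\<close>, even if every
  round pulls the paying arm, and is negligible once \<open>T \<ge> 36 K\<^sup>2 / \<epsilon>\<^sup>2\<close>. So an arm that is pulled
  in at most a fraction \<open>1 / K\<close> of the rounds when nothing pays is missed in a constant
  fraction of them when it pays, which costs \<open>\<Omega>(T M p)\<close>.

  The learner may use arbitrary measurable spaces, so the chi-square bound \<open>D\<close> between laws \<open>P\<close> and \<open>Q\<close>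
  is used in the form \<open>(\<integral> F dP)\<^sup>2 \<le> (1 + D) \<integral> F\<^sup>2 dQ\<close>, which needs no densities and composes along
  kernels.
\<close>

section \<open>The chi-square cost of one private answer\<close>

text \<open>Bounds on all events say that \<open>M\<close> lies below \<open>c\<close> times
  \<open>N\<close> as a measure, and nonnegative integrals are monotone in the measure. This moves
  the privacy condition from events to bounded test functions.\<close>

lemma integral_mono_scaled_measure:
  fixes f :: "'a \<Rightarrow> real"
  assumes "finite_measure M" "finite_measure N" and sets: "sets M = sets N" and c: "0 \<le> c"
    and le: "\<And>S. S \<in> sets N \<Longrightarrow> measure M S \<le> c * measure N S"
    and f: "f \<in> borel_measurable N" "\<And>y. 0 \<le> f y" "\<And>y. y \<in> space N \<Longrightarrow> f y \<le> B"
  shows "(\<integral>y. f y \<partial>M) \<le> c * (\<integral>y. f y \<partial>N)"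
proof -
  interpret M: finite_measure M by fact
  interpret N: finite_measure N by fact
  have "f \<in> borel_measurable M" using f(1) measurable_cong_sets[OF sets refl] by blast
  then have intM: "integrable M f"
    using f sets_eq_imp_space_eq[OF sets]
    by (intro M.integrable_const_bound[where B = B] AE_I2) auto
  have intN: "integrable N f"
    using f by (intro N.integrable_const_bound[where B = B] AE_I2) auto
  have "M \<le> scale_measure (ennreal c) N"
    using le c sets
    by (subst le_measure)
      (auto simp: M.emeasure_eq_measure N.emeasure_eq_measure ennreal_mult[symmetric] intro!: ennreal_leI)
  then have "(\<integral>\<^sup>+y. ennreal (f y) \<partial>M) \<le> (\<integral>\<^sup>+y. ennreal (f y) \<partial>scale_measure (ennreal c) N)"
    by (intro nn_integral_mono_measure) (simp_all add: sets)
  also have "\<dots> = ennreal c * (\<integral>\<^sup>+y. ennreal (f y) \<partial>N)"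
    using f by (intro nn_integral_scale_measure) auto
  finally show ?thesis
    using f c intM intN
    by (simp add: nn_integral_eq_integral ennreal_mult[symmetric] integral_nonneg_AE)
qed

text \<open>Cauchy-Schwarz in the plane for \<open>(1, \<bar>p\<bar> * k)\<close> and
  \<open>(\<bar>c\<bar>, sqrt s)\<close>. In the application \<open>c\<close> is the mean of a test
  function, \<open>d\<close> the change of that mean and \<open>s\<close> the variance, so
  \<open>c\<^sup>2 + s\<close> is the second moment.\<close>

lemma square_mixture_le:
  fixes c d p k s :: real
  assumes "\<bar>d\<bar> \<le> k * A" "A\<^sup>2 \<le> s" "0 \<le> k"
  shows "(c + p * d)\<^sup>2 \<le> (1 + p\<^sup>2 * k\<^sup>2) * (c\<^sup>2 + s)"
proof -
  have "d\<^sup>2 \<le> (k * A)\<^sup>2" using assms(1) by (metis abs_ge_zero power2_abs power_mono)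
  also have "\<dots> \<le> k\<^sup>2 * s" using assms(2) by (simp add: power_mult_distrib mult_left_mono)
  finally have d: "d\<^sup>2 \<le> k\<^sup>2 * s" .
  define e where "e = k * sqrt s"
  have s0: "0 \<le> s" using assms(2) by (meson order_trans zero_le_power2)
  then have e2: "e\<^sup>2 = k\<^sup>2 * s" by (simp add: e_def power_mult_distrib)
  have "\<bar>d\<bar> \<le> e" using d e2 s0 \<open>0 \<le> k\<close>
    by (metis abs_le_square_iff abs_of_nonneg e_def mult_nonneg_nonneg real_sqrt_ge_zero)
  then have "\<bar>c + p * d\<bar> \<le> \<bar>c\<bar> + \<bar>p\<bar> * e"
    using abs_triangle_ineq[of c "p * d"] mult_left_mono[of "\<bar>d\<bar>" e "\<bar>p\<bar>"] by (simp add: abs_mult)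
  then have "(c + p * d)\<^sup>2 \<le> (\<bar>c\<bar> + \<bar>p\<bar> * e)\<^sup>2"
    by (metis abs_ge_zero power2_abs power_mono)
  also have "\<dots> = c\<^sup>2 + p\<^sup>2 * e\<^sup>2 + 2 * (\<bar>p\<bar> * k * \<bar>c\<bar>) * sqrt s"
    by (simp add: power2_sum e_def power_mult_distrib)
  \<comment> \<open>The factor \<open>\<bar>p\<bar> * k\<close> is grouped with \<open>c\<close> and
    not with \<open>sqrt s\<close>; only then do the four terms factor into the claimed
    product.\<close>
  also have "\<dots> \<le> c\<^sup>2 + p\<^sup>2 * e\<^sup>2 + ((\<bar>p\<bar> * k * \<bar>c\<bar>)\<^sup>2 + (sqrt s)\<^sup>2)"
    using sum_squares_bound[of "\<bar>p\<bar> * k * \<bar>c\<bar>" "sqrt s"] by simp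
  also have "\<dots> = (1 + p\<^sup>2 * k\<^sup>2) * (c\<^sup>2 + s)"
    using s0 by (simp add: e2 power_mult_distrib algebra_simps)
  finally show ?thesis .
qed

text \<open>The likelihood ratio of \<open>(1 - p) M + p N\<close> to \<open>M\<close> is \<open>1 + p g\<close> with \<open>g\<close> centred and bounded by
  \<open>O(\<epsilon>)\<close>, so the mixture has chi-square distance \<open>O(p\<^sup>2 \<epsilon>\<^sup>2)\<close> from \<open>M\<close>. Testing against
  a function \<open>f\<close> expresses this without densities.\<close>

lemma private_mixture_chi_square:
  fixes f :: "'a \<Rightarrow> real"
  assumes "prob_space M" "prob_space N" and sets: "sets M = sets N" and \<epsilon>: "0 \<le> \<epsilon>"
    and MN: "\<And>S. S \<in> sets N \<Longrightarrow> measure M S \<le> exp \<epsilon> * measure N S"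
    and NM: "\<And>S. S \<in> sets N \<Longrightarrow> measure N S \<le> exp \<epsilon> * measure M S"
    and f: "f \<in> borel_measurable N" "\<And>y. y \<in> space N \<Longrightarrow> 0 \<le> f y" "\<And>y. y \<in> space N \<Longrightarrow> f y \<le> 1"
  shows "((1 - p) * (\<integral>y. f y \<partial>M) + p * (\<integral>y. f y \<partial>N))\<^sup>2
    \<le> (1 + p\<^sup>2 * (exp \<epsilon> - exp (- \<epsilon>))\<^sup>2) * (\<integral>y. (f y)\<^sup>2 \<partial>M)"
proof -
  interpret M: prob_space M by fact
  interpret N: prob_space N by fact
  note space = sets_eq_imp_space_eq[OF sets]
  have fM [measurable]: "f \<in> borel_measurable M" using f(1) measurable_cong_sets[OF sets refl] by blast
  note [measurable] = f(1)
  have int: "integrable M g" "integrable N g"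
    if "g \<in> borel_measurable M" "g \<in> borel_measurable N" "\<And>y. y \<in> space N \<Longrightarrow> \<bar>g y\<bar> \<le> 1" for g :: "'a \<Rightarrow> real"
    using that space
    by (auto intro!: M.integrable_const_bound[where B = 1] N.integrable_const_bound[where B = 1] AE_I2)
  have intf: "integrable M f" "integrable N f" using f by (intro int; auto)+
  define c where "c = (\<integral>y. f y \<partial>M)"
  have c: "0 \<le> c" "c \<le> 1"
    using f space intf unfolding c_def by (auto intro!: integral_nonneg_AE AE_I2 M.integral_le_const)
  \<comment> \<open>The comparison of integrals under \<open>M\<close> and \<open>N\<close> applies
    to nonnegative functions only, so the centred function is split into its two parts. Being
    centred under \<open>M\<close>, it has parts of equal \<open>M\<close>-mean
    \<open>A\<close>.\<close>
  define a where "a y = max 0 (f y - c)" for y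
  define b where "b y = max 0 (c - f y)" for y
  have [measurable]: "a \<in> borel_measurable M" "b \<in> borel_measurable M"
      "a \<in> borel_measurable N" "b \<in> borel_measurable N"
    unfolding a_def[abs_def] b_def[abs_def] by measurable
  have ab: "0 \<le> a y" "0 \<le> b y" "f y - c = a y - b y" for y by (auto simp: a_def b_def)
  have ab1: "a y \<le> 1" "b y \<le> 1" if "y \<in> space N" for y
    using f(2,3)[OF that] c by (auto simp: a_def b_def)
  have inta: "integrable M a" "integrable N a" and intb: "integrable M b" "integrable N b"
    using ab ab1 by (intro int; auto)+
  define A where "A = (\<integral>y. a y \<partial>M)"
  have "(\<integral>y. f y - c \<partial>M) = 0" using intf M.prob_space by (simp add: c_def)
  then have AB: "(\<integral>y. b y \<partial>M) = A" using inta intb by (simp add: ab A_def)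
  have "(\<integral>y. f y - c \<partial>N) = (\<integral>y. a y \<partial>N) - (\<integral>y. b y \<partial>N)" using inta intb by (simp add: ab)
  then have d: "(\<integral>y. f y \<partial>N) - c = (\<integral>y. a y \<partial>N) - (\<integral>y. b y \<partial>N)" using intf N.prob_space by simp
  have up: "(\<integral>y. g y \<partial>N) \<le> exp \<epsilon> * (\<integral>y. g y \<partial>M)" "exp (- \<epsilon>) * (\<integral>y. g y \<partial>M) \<le> (\<integral>y. g y \<partial>N)"
    if "g \<in> borel_measurable M" "g \<in> borel_measurable N" "\<And>y. 0 \<le> g y" "\<And>y. y \<in> space N \<Longrightarrow> g y \<le> 1" for g
  proof -
    show "(\<integral>y. g y \<partial>N) \<le> exp \<epsilon> * (\<integral>y. g y \<partial>M)"
      using that MN NM space sets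
      by (intro integral_mono_scaled_measure[where B = 1]) (auto intro: M.finite_measure_axioms N.finite_measure_axioms)
    have "(\<integral>y. g y \<partial>M) \<le> exp \<epsilon> * (\<integral>y. g y \<partial>N)"
      using that MN NM space sets
      by (intro integral_mono_scaled_measure[where B = 1]) (auto intro: M.finite_measure_axioms N.finite_measure_axioms)
    then show "exp (- \<epsilon>) * (\<integral>y. g y \<partial>M) \<le> (\<integral>y. g y \<partial>N)"
      by (simp add: exp_minus field_simps)
  qed
  \<comment> \<open>Both parts have their \<open>N\<close>-mean between
    \<open>exp (- \<epsilon>) * A\<close> and \<open>exp \<epsilon> * A\<close>, so these means
    differ by at most the length of that interval.\<close>
  have "\<bar>(\<integral>y. f y \<partial>N) - c\<bar> \<le> (exp \<epsilon> - exp (- \<epsilon>)) * A"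
    using up[of a] up[of b] ab ab1 d AB by (auto simp: A_def algebra_simps abs_le_iff)
  \<comment> \<open>The squared mean of the positive part is at most its second moment, hence at
    most the variance of \<open>f\<close> under \<open>M\<close>.\<close>
  moreover have "A\<^sup>2 \<le> (\<integral>y. (f y)\<^sup>2 \<partial>M) - c\<^sup>2"
  proof -
    have inta2: "integrable M (\<lambda>y. (a y)\<^sup>2)" and intf2: "integrable M (\<lambda>y. (f y)\<^sup>2)"
      using ab ab1 f by (intro int; auto simp: power_le_one)+
    have "A\<^sup>2 \<le> (\<integral>y. (a y)\<^sup>2 \<partial>M)"
      using M.variance_positive[of a] M.variance_eq[OF inta(1) inta2] by (simp add: A_def)
    also have "\<dots> \<le> (\<integral>y. (f y - c)\<^sup>2 \<partial>M)"
    proof (rule integral_mono[OF inta2])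
      show "integrable M (\<lambda>y. (f y - c)\<^sup>2)"
        unfolding power2_diff using intf intf2 by auto
      show "(a y)\<^sup>2 \<le> (f y - c)\<^sup>2" for y by (auto simp: a_def max_def)
    qed
    also have "\<dots> = (\<integral>y. (f y)\<^sup>2 \<partial>M) - c\<^sup>2"
      using M.variance_eq[OF intf(1) intf2] by (simp add: c_def)
    finally show ?thesis .
  qed
  ultimately have "(c + p * ((\<integral>y. f y \<partial>N) - c))\<^sup>2
      \<le> (1 + p\<^sup>2 * (exp \<epsilon> - exp (- \<epsilon>))\<^sup>2) * (c\<^sup>2 + ((\<integral>y. (f y)\<^sup>2 \<partial>M) - c\<^sup>2))"
    using \<epsilon> by (intro square_mixture_le) auto
  then show ?thesis by (simp add: c_def algebra_simps)
qed

text \<open>Source of the constant 9, the square of 3, in the chi-square bounds: a quadratic upper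
  bound for \<open>exp \<epsilon>\<close> meets the tangent bound for
  \<open>exp (- \<epsilon>)\<close>.\<close>

lemma exp_diff_le:
  fixes \<epsilon> :: real
  assumes "0 \<le> \<epsilon>" "\<epsilon> \<le> 1"
  shows "exp \<epsilon> - exp (- \<epsilon>) \<le> 3 * \<epsilon>"
proof -
  have "exp \<epsilon> \<le> 1 + \<epsilon> + \<epsilon>\<^sup>2" using assms by (rule exp_bound)
  moreover have "\<epsilon>\<^sup>2 \<le> \<epsilon>" using assms by (simp add: power2_eq_square mult_left_le)
  ultimately show ?thesis using exp_ge_add_one_self[of "- \<epsilon>"] by linarith
qed

text \<open>The form used for runs, whose expectations are nonnegative integrals. Since
  \<open>f\<close> is at most 1, it agrees with a real function, to which the real inequality
  applies.\<close>

lemma private_mixture_nn_integral: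
  fixes f :: "'a \<Rightarrow> ennreal"
  assumes "prob_space M" "prob_space N" and sets: "sets M = sets N"
    and \<epsilon>: "0 \<le> \<epsilon>" "\<epsilon> \<le> 1" and p: "0 \<le> p" "p \<le> 1"
    and MN: "\<And>S. S \<in> sets N \<Longrightarrow> measure M S \<le> exp \<epsilon> * measure N S"
    and NM: "\<And>S. S \<in> sets N \<Longrightarrow> measure N S \<le> exp \<epsilon> * measure M S"
    and f: "f \<in> borel_measurable N" "\<And>y. y \<in> space N \<Longrightarrow> f y \<le> 1"
  shows "((\<integral>\<^sup>+y. f y \<partial>N) * ennreal p + (\<integral>\<^sup>+y. f y \<partial>M) * ennreal (1 - p))\<^sup>2
    \<le> ennreal (1 + 9 * \<epsilon>\<^sup>2 * p\<^sup>2) * (\<integral>\<^sup>+y. (f y)\<^sup>2 \<partial>M)"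
proof -
  interpret M: prob_space M by fact
  interpret N: prob_space N by fact
  note space = sets_eq_imp_space_eq[OF sets]
  note [measurable] = f(1)
  have [measurable]: "f \<in> borel_measurable M" using f(1) measurable_cong_sets[OF sets refl] by blast
  define g where "g y = enn2real (f y)" for y
  have fg: "f y = ennreal (g y)" "0 \<le> g y" "g y \<le> 1" if "y \<in> space N" for y
    using f(2)[OF that] unfolding g_def
    by (auto simp: ennreal_enn2real_if enn2real_leI top_unique)
  have [measurable]: "g \<in> borel_measurable M" "g \<in> borel_measurable N"
    unfolding g_def[abs_def] by measurable
  have eqs: "(\<integral>\<^sup>+y. f y \<partial>N) = ennreal (\<integral>y. g y \<partial>N)" "(\<integral>\<^sup>+y. f y \<partial>M) = ennreal (\<integral>y. g y \<partial>M)"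
    "(\<integral>\<^sup>+y. (f y)\<^sup>2 \<partial>M) = ennreal (\<integral>y. (g y)\<^sup>2 \<partial>M)"
    using fg space
    by (subst nn_integral_eq_integral[symmetric];
        auto intro!: N.integrable_const_bound[where B = 1] M.integrable_const_bound[where B = 1]
          nn_integral_cong simp: power_le_one ennreal_power)+
  have k: "(exp \<epsilon> - exp (- \<epsilon>))\<^sup>2 \<le> (3 * \<epsilon>)\<^sup>2"
    using exp_diff_le[OF \<epsilon>] \<epsilon> by (intro power_mono) auto
  have nonneg: "0 \<le> (\<integral>y. g y \<partial>N)" "0 \<le> (\<integral>y. g y \<partial>M)" "0 \<le> (\<integral>y. (g y)\<^sup>2 \<partial>M)"
    by (auto simp: g_def)
  have "((1 - p) * (\<integral>y. g y \<partial>M) + p * (\<integral>y. g y \<partial>N))\<^sup>2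
      \<le> (1 + p\<^sup>2 * (exp \<epsilon> - exp (- \<epsilon>))\<^sup>2) * (\<integral>y. (g y)\<^sup>2 \<partial>M)"
    using assms fg by (intro private_mixture_chi_square) auto
  also have "\<dots> \<le> (1 + 9 * \<epsilon>\<^sup>2 * p\<^sup>2) * (\<integral>y. (g y)\<^sup>2 \<partial>M)"
    using mult_left_mono[OF k, of "p\<^sup>2"] nonneg
    by (intro mult_right_mono) (auto simp: algebra_simps)
  finally show ?thesis
    unfolding eqs using p nonneg
    by (simp add: ennreal_mult[symmetric] ennreal_plus[symmetric] ennreal_power ac_simps del: ennreal_plus)
qed

section \<open>Spike instances\<close>

definition arm_measures :: "nat \<Rightarrow> (nat \<Rightarrow> real measure) set" where
  "arm_measures K = {\<nu>. \<forall>a<K. prob_space (\<nu> a) \<and> sets (\<nu> a) = sets borel}"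

definition spike_arm :: "real \<Rightarrow> real \<Rightarrow> real measure" where
  "spike_arm M p = distr (measure_pmf (bernoulli_pmf p)) borel (\<lambda>b. if b then M else 0)"

text \<open>The arms that do not pay are spikes of weight 0, that is, point masses at 0, so one
  integration formula covers every arm.\<close>

definition spike_instance :: "real \<Rightarrow> real \<Rightarrow> nat \<Rightarrow> nat \<Rightarrow> real measure" where
  "spike_instance M p j a = spike_arm M (if a = j then p else 0)"

lemma nn_integral_spike_arm:
  assumes "0 \<le> p" "p \<le> 1" "f \<in> borel_measurable borel"
  shows "(\<integral>\<^sup>+x. f x \<partial>spike_arm M p) = f M * ennreal p + f 0 * ennreal (1 - p)"
  using assms by (simp add: spike_arm_def nn_integral_distr)

lemma prob_space_spike_arm: "prob_space (spike_arm M p)"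
  unfolding spike_arm_def by (intro measure_pmf.prob_space_distr) simp

lemma sets_spike_arm: "sets (spike_arm M p) = sets borel"
  by (simp add: spike_arm_def)

lemma arm_mean_spike_arm:
  assumes "0 \<le> p" "p \<le> 1"
  shows "arm_mean (spike_arm M p) = M * p"
  using assms by (simp add: arm_mean_def spike_arm_def integral_distr)

lemma spike_instance_arm_measures: "spike_instance M p j \<in> arm_measures K"
  by (simp add: arm_measures_def spike_instance_def prob_space_spike_arm sets_spike_arm)

lemma heavy_tailed_spike_instance:
  assumes "0 \<le> p" "p \<le> 1" "\<bar>M\<bar> powr (1 + v) * p \<le> 1"
  shows "heavy_tailed_instance K v (spike_instance M p j)"
proof -
  have "(\<integral>\<^sup>+x. ennreal (\<bar>x\<bar> powr (1 + v)) \<partial>spike_arm M (if a = j then p else 0)) \<le> 1" for a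
    \<comment> \<open>The value 0 contributes nothing, since
      \<open>0 powr (1 + v) = 0\<close>.\<close>
    using assms by (subst nn_integral_spike_arm) (auto simp: ennreal_mult[symmetric])
  then show ?thesis
    by (simp add: heavy_tailed_instance_def spike_instance_def prob_space_spike_arm sets_spike_arm)
qed

section \<open>Integrals over runs\<close>

locale bandit_run =
  fixes K T :: nat and A :: "('u, 'y) bandit_algorithm"
  assumes bandit: "bandit_algorithm K T A"
begin

abbreviation U where "U \<equiv> seed A"
abbreviation Y where "Y \<equiv> outputs A"
abbreviation V where "V \<equiv> view_space K Y"
abbreviation R where "R \<equiv> run_space K A"

section \<open>Measurability of the learner's components and of updates\<close>

lemma pull_measurable:
  "t < T \<Longrightarrow> (\<lambda>w. pull A t (fst w) (snd w)) \<in> U \<Otimes>\<^sub>M V t \<rightarrow>\<^sub>M count_space {..<K}"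
  using bandit by (simp add: bandit_algorithm_def case_prod_unfold)

lemma priv_measurable:
  "t < T \<Longrightarrow> (\<lambda>w. priv A t (fst (fst w)) (snd (fst w)) (fst (snd w)) (snd (snd w)))
    \<in> (U \<Otimes>\<^sub>M V t) \<Otimes>\<^sub>M (count_space {..<K} \<Otimes>\<^sub>M borel) \<rightarrow>\<^sub>M subprob_algebra Y"
  using bandit by (auto simp add: bandit_algorithm_def case_prod_unfold intro: measurable_prob_algebraD)

lemma view_measurable:
  "(\<lambda>w. (fst w, view t (snd w))) \<in> R t \<rightarrow>\<^sub>M U \<Otimes>\<^sub>M V t"
  unfolding run_space_def view_space_def view_def by measurable

lemma update_view_measurable:
  "(\<lambda>w. (fst (fst w), (snd (fst w))(t := snd w)))
    \<in> (U \<Otimes>\<^sub>M V t) \<Otimes>\<^sub>M (count_space {..<K} \<Otimes>\<^sub>M Y) \<rightarrow>\<^sub>M U \<Otimes>\<^sub>M V (Suc t)"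
  unfolding view_space_def lessThan_Suc by measurable

lemma update_run_measurable:
  "(\<lambda>w. (fst (fst w), (snd (fst w))(t := snd w)))
    \<in> R t \<Otimes>\<^sub>M (count_space {..<K} \<Otimes>\<^sub>M (borel \<Otimes>\<^sub>M Y)) \<rightarrow>\<^sub>M R (Suc t)"
  unfolding run_space_def lessThan_Suc by measurable

lemma instance_measurable:
  assumes "\<nu> \<in> arm_measures K"
  shows "\<nu> \<in> count_space {..<K} \<rightarrow>\<^sub>M subprob_algebra borel"
  using assms by (auto simp: arm_measures_def space_subprob_algebra prob_space_imp_subprob_space)

section \<open>A single round as a kernel on runs, and the law of a run\<close>

definition arm :: "nat \<Rightarrow> ('u, 'y) run \<Rightarrow> nat" where
  "arm t w = pull A t (fst w) (view t (snd w))"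

definition reply :: "nat \<Rightarrow> ('u, 'y) run \<Rightarrow> real \<Rightarrow> 'y measure" where
  "reply t w = priv A t (fst w) (view t (snd w)) (arm t w)"

definition append_round :: "nat \<Rightarrow> ('u, 'y) run \<Rightarrow> real \<Rightarrow> 'y \<Rightarrow> ('u, 'y) run" where
  "append_round t w x y = (fst w, (snd w)(t := (arm t w, x, y)))"

lemma extend_run_eq:
  "extend_run K \<nu> A t w =
    \<nu> (arm t w) \<bind> (\<lambda>x. reply t w x \<bind> (\<lambda>y. return (R (Suc t)) (append_round t w x y)))"
  by (simp add: extend_run_def arm_def reply_def append_round_def case_prod_unfold Let_def)

context
  fixes t assumes t: "t < T"
begin

lemma arm_measurable: "arm t \<in> R t \<rightarrow>\<^sub>M count_space {..<K}"
  using measurable_compose[OF view_measurable pull_measurable[OF t]] unfolding arm_def by simp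

lemma reply_measurable:
  "(\<lambda>w. reply t (fst w) (snd w)) \<in> R t \<Otimes>\<^sub>M borel \<rightarrow>\<^sub>M subprob_algebra Y"
proof -
  note [measurable] = view_measurable arm_measurable
  have "(\<lambda>w. ((fst (fst w), view t (snd (fst w))), arm t (fst w), snd w))
      \<in> R t \<Otimes>\<^sub>M borel \<rightarrow>\<^sub>M (U \<Otimes>\<^sub>M V t) \<Otimes>\<^sub>M (count_space {..<K} \<Otimes>\<^sub>M (borel :: real measure))"
    using measurable_compose[OF measurable_fst view_measurable] by measurable
  from measurable_compose[OF this priv_measurable[OF t]] show ?thesis
    unfolding reply_def by simp
qed

lemma append_round_measurable:
  "(\<lambda>w. append_round t (fst (fst w)) (snd (fst w)) (snd w)) \<in> (R t \<Otimes>\<^sub>M borel) \<Otimes>\<^sub>M Y \<rightarrow>\<^sub>M R (Suc t)"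
proof -
  note [measurable] = arm_measurable
  have "(\<lambda>w. (fst (fst w), arm t (fst (fst w)), snd (fst w), snd w))
      \<in> (R t \<Otimes>\<^sub>M borel) \<Otimes>\<^sub>M Y \<rightarrow>\<^sub>M R t \<Otimes>\<^sub>M (count_space {..<K} \<Otimes>\<^sub>M ((borel :: real measure) \<Otimes>\<^sub>M Y))"
    by measurable
  from measurable_compose[OF this update_run_measurable] show ?thesis
    unfolding append_round_def by simp
qed

lemma reply_bind_measurable:
  "(\<lambda>w. reply t (fst w) (snd w) \<bind> (\<lambda>y. return (R (Suc t)) (append_round t (fst w) (snd w) y)))
    \<in> R t \<Otimes>\<^sub>M borel \<rightarrow>\<^sub>M subprob_algebra (R (Suc t))"
  by (rule measurable_bind[OF reply_measurable])
    (rule measurable_compose[OF append_round_measurable return_measurable])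

lemma extend_run_measurable:
  assumes "\<nu> \<in> arm_measures K"
  shows "extend_run K \<nu> A t \<in> R t \<rightarrow>\<^sub>M subprob_algebra (R (Suc t))"
  unfolding extend_run_eq[abs_def]
  by (rule measurable_bind[OF measurable_compose[OF arm_measurable instance_measurable[OF assms]] reply_bind_measurable])

lemma nn_integral_extend_run:
  assumes \<nu>: "\<nu> \<in> arm_measures K" and w: "w \<in> space (R t)" and F: "F \<in> borel_measurable (R (Suc t))"
  shows "(\<integral>\<^sup>+z. F z \<partial>extend_run K \<nu> A t w) =
    (\<integral>\<^sup>+x. \<integral>\<^sup>+y. F (append_round t w x y) \<partial>reply t w x \<partial>\<nu> (arm t w))"
proof -
  have a: "arm t w < K"
    using measurable_space[OF arm_measurable w] by simp
  then have sets: "sets (\<nu> (arm t w)) = sets borel" using \<nu> by (simp add: arm_measures_def)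
  have *: "(\<lambda>x. reply t w x \<bind> (\<lambda>y. return (R (Suc t)) (append_round t w x y)))
      \<in> \<nu> (arm t w) \<rightarrow>\<^sub>M subprob_algebra (R (Suc t))"
    unfolding measurable_cong_sets[OF sets refl]
    using measurable_Pair2[OF reply_bind_measurable w] by simp
  have "(\<integral>\<^sup>+z. F z \<partial>(reply t w x \<bind> (\<lambda>y. return (R (Suc t)) (append_round t w x y)))) =
      (\<integral>\<^sup>+y. F (append_round t w x y) \<partial>reply t w x)" for x
  proof -
    have r: "sets (reply t w x) = sets Y"
      using sets_kernel[OF measurable_Pair2[OF reply_measurable w], of x] by simp
    have wx: "(w, x) \<in> space (R t \<Otimes>\<^sub>M borel)" using w by (simp add: space_pair_measure)
    have m: "append_round t w x \<in> reply t w x \<rightarrow>\<^sub>M R (Suc t)"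
      unfolding measurable_cong_sets[OF r refl]
      using measurable_Pair2[OF append_round_measurable wx] by simp
    show ?thesis
      by (subst nn_integral_bind[OF F measurable_compose[OF m return_measurable]])
        (intro nn_integral_cong nn_integral_return F measurable_space[OF m])
  qed
  then show ?thesis
    unfolding extend_run_eq by (subst nn_integral_bind[OF F *]) simp
qed

end

text \<open>Sub-probability is what measurability of \<open>bind\<close> delivers, and mass at most
  1 is what the later estimates use.\<close>

lemma run_law_space:
  assumes \<nu>: "\<nu> \<in> arm_measures K" and "t \<le> T"
  shows "run_law K \<nu> A t \<in> space (subprob_algebra (R t))"
  using \<open>t \<le> T\<close>
proof (induction t)
  case 0
  interpret prob_space U using bandit by (simp add: bandit_algorithm_def)
  \<comment> \<open>The function that is \<open>undefined\<close> everywhere is the only point of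
    the empty product.\<close>
  have "(\<lambda>u. (u, \<lambda>_. undefined)) \<in> U \<rightarrow>\<^sub>M R 0"
    unfolding run_space_def by (simp add: space_PiM_empty)
  then show ?case
    by (simp add: space_subprob_algebra prob_space_distr prob_space_imp_subprob_space)
next
  case (Suc t)
  then have "t < T" "run_law K \<nu> A t \<in> space (subprob_algebra (R t))" by auto
  from measurable_space[OF measurable_bind2[OF measurable_ident extend_run_measurable[OF this(1) \<nu>]], OF this(2)]
  show ?case by simp
qed

lemma sets_run_law:
  assumes "\<nu> \<in> arm_measures K" and "t \<le> T"
  shows "sets (run_law K \<nu> A t) = sets (R t)"
  using run_law_space[OF assms] by (simp add: space_subprob_algebra)

text \<open>The later inductions over rounds rest on this recursion for expectations.\<close>

lemma nn_integral_run_law_Suc: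
  assumes \<nu>: "\<nu> \<in> arm_measures K" and t: "t < T" and F: "F \<in> borel_measurable (R (Suc t))"
  shows "(\<integral>\<^sup>+z. F z \<partial>run_law K \<nu> A (Suc t)) =
    (\<integral>\<^sup>+w. \<integral>\<^sup>+x. \<integral>\<^sup>+y. F (append_round t w x y) \<partial>reply t w x \<partial>\<nu> (arm t w) \<partial>run_law K \<nu> A t)"
proof -
  have sets: "sets (run_law K \<nu> A t) = sets (R t)" using sets_run_law[OF \<nu>] t by simp
  show ?thesis
    unfolding run_law.simps
    apply (subst nn_integral_bind[OF F])
    subgoal unfolding measurable_cong_sets[OF sets refl] by (rule extend_run_measurable[OF t \<nu>])
    subgoal by (intro nn_integral_cong nn_integral_extend_run[OF t \<nu> _ F]) (simp add: sets_eq_imp_space_eq[OF sets])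
    done
qed

text \<open>The transition operator of the learner's view, acting on functions: the conditional
  expectation of \<open>F\<close> after round \<open>t\<close> given the view before it. The true
  reward is integrated out, so no law on views has to be constructed.\<close>

definition view_step :: "nat \<Rightarrow> (nat \<Rightarrow> real measure) \<Rightarrow> ('u \<times> (nat \<Rightarrow> nat \<times> 'y) \<Rightarrow> ennreal)
    \<Rightarrow> 'u \<times> (nat \<Rightarrow> nat \<times> 'y) \<Rightarrow> ennreal" where
  "view_step t \<nu> F w =
    (let a = pull A t (fst w) (snd w)
     in \<integral>\<^sup>+x. \<integral>\<^sup>+y. F (fst w, (snd w)(t := (a, y))) \<partial>priv A t (fst w) (snd w) a x \<partial>\<nu> a)"

context
  fixes t assumes t: "t < T"
begin

lemma view_step_inner_measurable:
  assumes F: "F \<in> borel_measurable (U \<Otimes>\<^sub>M V (Suc t))"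
  shows "(\<lambda>z. \<integral>\<^sup>+y. F (fst (fst z), (snd (fst z))(t := (pull A t (fst (fst z)) (snd (fst z)), y)))
        \<partial>priv A t (fst (fst z)) (snd (fst z)) (pull A t (fst (fst z)) (snd (fst z))) (snd z))
      \<in> borel_measurable ((U \<Otimes>\<^sub>M V t) \<Otimes>\<^sub>M borel)"
proof (rule nn_integral_measurable_subprob_algebra2)
  have "(\<lambda>z. (fst z, pull A t (fst (fst z)) (snd (fst z)), snd z))
      \<in> (U \<Otimes>\<^sub>M V t) \<Otimes>\<^sub>M borel \<rightarrow>\<^sub>M (U \<Otimes>\<^sub>M V t) \<Otimes>\<^sub>M (count_space {..<K} \<Otimes>\<^sub>M (borel :: real measure))"
    using measurable_compose[OF measurable_fst pull_measurable[OF t]] by measurable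
  from measurable_compose[OF this priv_measurable[OF t]]
  show "(\<lambda>z. priv A t (fst (fst z)) (snd (fst z)) (pull A t (fst (fst z)) (snd (fst z))) (snd z))
      \<in> (U \<Otimes>\<^sub>M V t) \<Otimes>\<^sub>M borel \<rightarrow>\<^sub>M subprob_algebra Y" by simp
  have "(\<lambda>z. (fst (fst z), pull A t (fst (fst (fst z))) (snd (fst (fst z))), snd z))
      \<in> ((U \<Otimes>\<^sub>M V t) \<Otimes>\<^sub>M (borel :: real measure)) \<Otimes>\<^sub>M Y \<rightarrow>\<^sub>M (U \<Otimes>\<^sub>M V t) \<Otimes>\<^sub>M (count_space {..<K} \<Otimes>\<^sub>M Y)"
    using measurable_compose[OF measurable_compose[OF measurable_fst measurable_fst] pull_measurable[OF t]]
    by measurable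
  from measurable_compose[OF measurable_compose[OF this update_view_measurable] F]
  show "(\<lambda>(z, y). F (fst (fst z), (snd (fst z))(t := (pull A t (fst (fst z)) (snd (fst z)), y))))
      \<in> borel_measurable (((U \<Otimes>\<^sub>M V t) \<Otimes>\<^sub>M (borel :: real measure)) \<Otimes>\<^sub>M Y)"
    by (simp add: case_prod_unfold)
qed

lemma view_step_measurable:
  assumes "\<nu> \<in> arm_measures K" and F: "F \<in> borel_measurable (U \<Otimes>\<^sub>M V (Suc t))"
  shows "view_step t \<nu> F \<in> borel_measurable (U \<Otimes>\<^sub>M V t)"
  unfolding view_step_def[abs_def] Let_def
  by (rule nn_integral_measurable_subprob_algebra2
      [OF _ measurable_compose[OF pull_measurable[OF t] instance_measurable[OF assms(1)]]])
    (use view_step_inner_measurable[OF F] in \<open>simp add: case_prod_unfold\<close>)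

text \<open>Both the arm and the private map depend on the run only through its view, so functions
  of the view pull back to functions of the view.\<close>

lemma nn_integral_view_Suc:
  assumes \<nu>: "\<nu> \<in> arm_measures K" and F: "F \<in> borel_measurable (U \<Otimes>\<^sub>M V (Suc t))"
  shows "(\<integral>\<^sup>+w. F (fst w, view (Suc t) (snd w)) \<partial>run_law K \<nu> A (Suc t)) =
    (\<integral>\<^sup>+w. view_step t \<nu> F (fst w, view t (snd w)) \<partial>run_law K \<nu> A t)"
proof -
  have *: "view (Suc t) (snd (append_round t w x y)) = (view t (snd w))(t := (arm t w, y))" for w x y
    by (auto simp: view_def append_round_def fun_eq_iff less_Suc_eq)
  show ?thesis
    unfolding nn_integral_run_law_Suc[OF \<nu> t measurable_compose[OF view_measurable F]] *
    by (simp add: view_step_def Let_def arm_def reply_def append_round_def)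
qed

lemma priv_prob_space:
  assumes "u \<in> space U" "h \<in> space (V t)" "a < K"
  shows "prob_space (priv A t u h a x)" "sets (priv A t u h a x) = sets Y"
proof -
  have "(\<lambda>((u, h), a, x). priv A t u h a x)
        \<in> (U \<Otimes>\<^sub>M V t) \<Otimes>\<^sub>M (count_space {..<K} \<Otimes>\<^sub>M borel) \<rightarrow>\<^sub>M prob_algebra Y"
    using bandit t by (simp add: bandit_algorithm_def)
  from measurable_space[OF this, of "((u, h), a, x)"]
  show "prob_space (priv A t u h a x)" "sets (priv A t u h a x) = sets Y"
    using assms by (auto simp: space_pair_measure space_prob_algebra)
qed

lemma reply_prob_space:
  assumes "w \<in> space (R t)"
  shows "prob_space (reply t w x)"
  using measurable_space[OF view_measurable assms] measurable_space[OF arm_measurable[OF t] assms]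
  unfolding reply_def by (intro priv_prob_space) (auto simp: space_pair_measure)

text \<open>Puts a round into the shape of \<open>private_mixture_nn_integral\<close>: a mixture of
  the private answers to the rewards \<open>M\<close> and \<open>0\<close>, trivial unless arm
  \<open>j\<close> is pulled.\<close>

lemma view_step_spike:
  fixes q M p j defines "q u h \<equiv> (if pull A t u h = j then p else 0)"
  assumes p: "0 \<le> p" "p \<le> 1" and F: "F \<in> borel_measurable (U \<Otimes>\<^sub>M V (Suc t))"
    and u: "u \<in> space U" and h: "h \<in> space (V t)"
  shows "view_step t (spike_instance M p j) F (u, h) =
    (\<integral>\<^sup>+y. F (u, h(t := (pull A t u h, y))) \<partial>priv A t u h (pull A t u h) M) * ennreal (q u h)
    + (\<integral>\<^sup>+y. F (u, h(t := (pull A t u h, y))) \<partial>priv A t u h (pull A t u h) 0) * ennreal (1 - q u h)"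
proof -
  have "(\<lambda>x. \<integral>\<^sup>+y. F (u, h(t := (pull A t u h, y))) \<partial>priv A t u h (pull A t u h) x) \<in> borel_measurable borel"
    using measurable_Pair2[OF view_step_inner_measurable[OF F], of "(u, h)"] u h
    by (simp add: space_pair_measure)
  from nn_integral_spike_arm[OF _ _ this, of "q u h" M] p show ?thesis
    by (auto simp: view_step_def spike_instance_def Let_def q_def)
qed

end

section \<open>Expected rewards in terms of pulls of the paying arm\<close>

lemma round_measurable:
  "s < n \<Longrightarrow> (\<lambda>w. snd w s) \<in> R n \<rightarrow>\<^sub>M count_space {..<K} \<Otimes>\<^sub>M (borel \<Otimes>\<^sub>M Y)"
  unfolding run_space_def
  by (rule measurable_compose[OF measurable_snd measurable_component_singleton]) simp

lemma reward_measurable: "s < n \<Longrightarrow> (\<lambda>w. fst (snd (snd w s))) \<in> borel_measurable (R n)"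
  using measurable_compose[OF round_measurable, of s n "\<lambda>z. fst (snd z)" borel] by simp

lemma pulled_measurable: "s < n \<Longrightarrow> (\<lambda>w. of_bool (fst (snd w s) = j) :: ennreal) \<in> borel_measurable (R n)"
  using measurable_compose[OF measurable_compose[OF round_measurable measurable_fst],
      of s n "\<lambda>a. of_bool (a = j)" borel] by simp

text \<open>A Wald-type identity: given the past, a pull of arm \<open>j\<close> pays
  \<open>M * p\<close> on average and any other pull pays 0.\<close>

lemma pulls_eq_rewards:
  assumes p: "0 \<le> p" "p \<le> 1" and M: "0 \<le> M" and "t \<le> T"
  shows "(\<integral>\<^sup>+w. (\<Sum>s<t. ennreal (fst (snd (snd w s)))) \<partial>run_law K (spike_instance M p j) A t) =
    (\<integral>\<^sup>+w. (\<Sum>s<t. ennreal (M * p) * of_bool (fst (snd w s) = j)) \<partial>run_law K (spike_instance M p j) A t)"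
  using \<open>t \<le> T\<close>
proof (induction t)
  case (Suc t)
  then have t: "t < T" by simp
  let ?\<nu> = "spike_instance M p j"
  note \<nu> = spike_instance_arm_measures[of M p j K]
  have sets: "sets (run_law K ?\<nu> A t) = sets (R t)" using sets_run_law[OF \<nu>] t by simp
  have arm: "(\<lambda>w. of_bool (arm t w = j) :: ennreal) \<in> borel_measurable (R t)"
    using measurable_compose[OF arm_measurable[OF t], of "\<lambda>a. of_bool (a = j)" borel] by simp
  \<comment> \<open>Stated for any functional \<open>f\<close> of a round with the given conditional
    mean, so that it applies to rewards and to weighted pulls alike. Both sums then grow by the same
    increment.\<close>
  have step: "(\<integral>\<^sup>+w. (\<Sum>s<Suc t. f (snd w s)) \<partial>run_law K ?\<nu> A (Suc t)) =
      (\<integral>\<^sup>+w. (\<Sum>s<t. f (snd w s)) \<partial>run_law K ?\<nu> A t) +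
      (\<integral>\<^sup>+w. ennreal (M * p) * of_bool (arm t w = j) \<partial>run_law K ?\<nu> A t)"
    if f: "\<And>s n. s < n \<Longrightarrow> (\<lambda>w. f (snd w s)) \<in> borel_measurable (R n)"
      and g: "\<And>x y a. f (a, x, y) = g a x" "\<And>a. g a \<in> borel_measurable borel"
      and mean: "\<And>a. (\<integral>\<^sup>+x. g a x \<partial>?\<nu> a) = ennreal (M * p) * of_bool (a = j)"
    for f :: "nat \<times> real \<times> 'y \<Rightarrow> ennreal" and g
  proof -
    have "(\<integral>\<^sup>+w. (\<Sum>s<Suc t. f (snd w s)) \<partial>run_law K ?\<nu> A (Suc t)) =
      (\<integral>\<^sup>+w. \<integral>\<^sup>+x. \<integral>\<^sup>+y. (\<Sum>s<t. f (snd w s)) + g (arm t w) x \<partial>reply t w x \<partial>?\<nu> (arm t w)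
        \<partial>run_law K ?\<nu> A t)"
      using f by (subst nn_integral_run_law_Suc[OF \<nu> t]) (auto simp: append_round_def g)
    also have "\<dots> = (\<integral>\<^sup>+w. (\<Sum>s<t. f (snd w s)) + ennreal (M * p) * of_bool (arm t w = j) \<partial>run_law K ?\<nu> A t)"
    proof (rule nn_integral_cong)
      fix w assume "w \<in> space (run_law K ?\<nu> A t)"
      then have w: "w \<in> space (R t)" using sets_eq_imp_space_eq[OF sets] by simp
      interpret arm: prob_space "?\<nu> (arm t w)" by (simp add: spike_instance_def prob_space_spike_arm)
      have "(\<integral>\<^sup>+y. c \<partial>reply t w x) = c" for c :: ennreal and x
        using prob_space.emeasure_space_1[OF reply_prob_space[OF t w, of x]] by simp
      moreover have "g (arm t w) \<in> borel_measurable (?\<nu> (arm t w))"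
        using g(2) by (simp add: spike_instance_def spike_arm_def)
      ultimately show "(\<integral>\<^sup>+x. \<integral>\<^sup>+y. (\<Sum>s<t. f (snd w s)) + g (arm t w) x \<partial>reply t w x \<partial>?\<nu> (arm t w)) =
          (\<Sum>s<t. f (snd w s)) + ennreal (M * p) * of_bool (arm t w = j)"
        by (simp add: nn_integral_add arm.emeasure_space_1 mean)
    qed
    also have "\<dots> = (\<integral>\<^sup>+w. (\<Sum>s<t. f (snd w s)) \<partial>run_law K ?\<nu> A t) +
        (\<integral>\<^sup>+w. ennreal (M * p) * of_bool (arm t w = j) \<partial>run_law K ?\<nu> A t)"
      using f arm by (intro nn_integral_add) (auto simp: measurable_cong_sets[OF sets refl])
    finally show ?thesis .
  qed
  have "(\<integral>\<^sup>+x. ennreal x \<partial>?\<nu> a) = ennreal (M * p) * of_bool (a = j)" for a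
    using p M by (simp add: spike_instance_def nn_integral_spike_arm ennreal_mult)
  moreover have "(\<integral>\<^sup>+x. ennreal (M * p) * of_bool (a = j) \<partial>?\<nu> a) = ennreal (M * p) * of_bool (a = j)" for a
  proof -
    interpret arm: prob_space "?\<nu> a" by (simp add: spike_instance_def prob_space_spike_arm)
    show ?thesis by (simp add: arm.emeasure_space_1)
  qed
  ultimately show ?case
    using step[of "\<lambda>z. ennreal (fst (snd z))" "\<lambda>a x. ennreal x"]
      step[of "\<lambda>z. ennreal (M * p) * of_bool (fst z = j)" "\<lambda>a x. ennreal (M * p) * of_bool (a = j)"]
      Suc reward_measurable pulled_measurable by simp
qed simp

end

section \<open>Indistinguishability of the instances\<close>

locale private_bandit_run =
  fixes \<epsilon> :: real and K T :: nat and A :: "('u, 'y) bandit_algorithm"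
  assumes ldp: "ldp_algorithm \<epsilon> K T A" and privacy_level: "0 \<le> \<epsilon>" "\<epsilon> \<le> 1"

sublocale private_bandit_run \<subseteq> bandit_run
  using ldp by unfold_locales (simp add: ldp_algorithm_def)

context private_bandit_run
begin

text \<open>For every \<open>j'\<close>, \<open>spike_instance M 0 j'\<close> is the instance in which no arm pays.\<close>

lemma view_step_chi_square:
  assumes t: "t < T" and p: "0 \<le> p" "p \<le> 1" and w: "w \<in> space (U \<Otimes>\<^sub>M V t)"
    and F: "F \<in> borel_measurable (U \<Otimes>\<^sub>M V (Suc t))" and F1: "\<And>w. w \<in> space (U \<Otimes>\<^sub>M V (Suc t)) \<Longrightarrow> F w \<le> 1"
  shows "(view_step t (spike_instance M p j) F w)\<^sup>2
    \<le> ennreal (1 + 9 * \<epsilon>\<^sup>2 * p\<^sup>2) * view_step t (spike_instance M 0 j') (\<lambda>w. (F w)\<^sup>2) w"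
    and "view_step t (spike_instance M p j) F w \<le> 1"
proof -
  obtain u h where uh: "w = (u, h)" "u \<in> space U" "h \<in> space (V t)"
    using w by (auto simp: space_pair_measure)
  define a where "a = pull A t u h"
  have a: "a < K" using measurable_space[OF pull_measurable[OF t] w] by (simp add: a_def uh)
  \<comment> \<open>The weight of the spike on the arm actually pulled.\<close>
  define q where "q = (if a = j then p else 0)"
  have q: "0 \<le> q" "q \<le> p" "q \<le> 1" using p by (auto simp: q_def)
  have F2: "(\<lambda>w. (F w)\<^sup>2) \<in> borel_measurable (U \<Otimes>\<^sub>M V (Suc t))" using F by measurable
  define N where "N = priv A t u h a"
  have N: "prob_space (N x)" "sets (N x) = sets Y" for x
    using priv_prob_space[OF t uh(2,3) a] by (auto simp: N_def)
  have "locally_private \<epsilon> borel Y N" using ldp t uh a by (simp add: ldp_algorithm_def N_def)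
  then have priv: "measure (N x) S \<le> exp \<epsilon> * measure (N x') S" if "S \<in> sets Y" for x x' S
    using that by (auto simp: locally_private_def)
  have "(\<lambda>y. ((u, h), (a, y))) \<in> Y \<rightarrow>\<^sub>M (U \<Otimes>\<^sub>M V t) \<Otimes>\<^sub>M (count_space {..<K} \<Otimes>\<^sub>M Y)"
    using uh a by (intro measurable_Pair measurable_const measurable_ident) (simp_all add: space_pair_measure)
  from measurable_compose[OF this update_view_measurable]
  have m: "(\<lambda>y. (u, h(t := (a, y)))) \<in> Y \<rightarrow>\<^sub>M U \<Otimes>\<^sub>M V (Suc t)" by simp
  define f where "f y = F (u, h(t := (a, y)))" for y
  have f: "f \<in> borel_measurable Y" "\<And>y. y \<in> space Y \<Longrightarrow> f y \<le> 1"
    using measurable_compose[OF m F] F1[OF measurable_space[OF m]] by (auto simp: f_def[abs_def])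
  have fN: "f \<in> borel_measurable (N x)" for x using f(1) measurable_cong_sets[OF N(2) refl] by blast
  have f1N: "y \<in> space (N x) \<Longrightarrow> f y \<le> 1" for x y using f(2) sets_eq_imp_space_eq[OF N(2)] by simp
  have eq: "view_step t (spike_instance M p j) F w =
      (\<integral>\<^sup>+y. f y \<partial>N M) * ennreal q + (\<integral>\<^sup>+y. f y \<partial>N 0) * ennreal (1 - q)"
    unfolding uh(1) by (subst view_step_spike[OF t p F uh(2,3)]) (simp add: a_def q_def N_def f_def[abs_def])
  have "(view_step t (spike_instance M p j) F w)\<^sup>2 \<le> ennreal (1 + 9 * \<epsilon>\<^sup>2 * q\<^sup>2) * (\<integral>\<^sup>+y. (f y)\<^sup>2 \<partial>N 0)"
    unfolding eq using N priv fN f1N q privacy_level by (intro private_mixture_nn_integral) auto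
  \<comment> \<open>Here the information which arm was pulled is given up: every round is charged as
    if it pulled arm \<open>j\<close>.\<close>
  also have "\<dots> \<le> ennreal (1 + 9 * \<epsilon>\<^sup>2 * p\<^sup>2) * (\<integral>\<^sup>+y. (f y)\<^sup>2 \<partial>N 0)"
    using q by (intro mult_right_mono ennreal_leI add_left_mono mult_left_mono power_mono) auto
  also have "(\<integral>\<^sup>+y. (f y)\<^sup>2 \<partial>N 0) = view_step t (spike_instance M 0 j') (\<lambda>w. (F w)\<^sup>2) w"
    unfolding uh(1) by (subst view_step_spike[OF t _ _ F2 uh(2,3)]) (simp_all add: a_def N_def f_def[abs_def])
  finally show "(view_step t (spike_instance M p j) F w)\<^sup>2
    \<le> ennreal (1 + 9 * \<epsilon>\<^sup>2 * p\<^sup>2) * view_step t (spike_instance M 0 j') (\<lambda>w. (F w)\<^sup>2) w" .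
  \<comment> \<open>The bound by 1 must survive the pull-back, because the induction over rounds
    applies its hypothesis to \<open>view_step\<close>.\<close>
  have "(\<integral>\<^sup>+y. f y \<partial>N x) \<le> (\<integral>\<^sup>+y. 1 \<partial>N x)" for x using f1N by (intro nn_integral_mono)
  then have "(\<integral>\<^sup>+y. f y \<partial>N x) \<le> 1" for x using prob_space.emeasure_space_1[OF N(1)] by simp
  then have "view_step t (spike_instance M p j) F w \<le> 1 * ennreal q + 1 * ennreal (1 - q)"
    unfolding eq by (intro add_mono mult_right_mono) auto
  also have "\<dots> = 1" using q by (simp add: ennreal_plus[symmetric] del: ennreal_plus)
  finally show "view_step t (spike_instance M p j) F w \<le> 1" .
qed

text \<open>The last round is peeled off. The induction hypothesis, for arbitrary \<open>F\<close>,
  is applied to \<open>view_step\<close> of \<open>F\<close> in the paying instance; its square is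
  bounded pointwise by \<open>view_step\<close> of the square in the base instance, at the price of
  one more factor.\<close>

lemma run_law_chi_square:
  assumes p: "0 \<le> p" "p \<le> 1" and "t \<le> T"
    and "F \<in> borel_measurable (U \<Otimes>\<^sub>M V t)" and "\<And>w. w \<in> space (U \<Otimes>\<^sub>M V t) \<Longrightarrow> F w \<le> 1"
  shows "(\<integral>\<^sup>+w. F (fst w, view t (snd w)) \<partial>run_law K (spike_instance M p j) A t)\<^sup>2
    \<le> ennreal ((1 + 9 * \<epsilon>\<^sup>2 * p\<^sup>2) ^ t)
      * (\<integral>\<^sup>+w. (F (fst w, view t (snd w)))\<^sup>2 \<partial>run_law K (spike_instance M 0 j') A t)"
  using assms(3-5)
proof (induction t arbitrary: F)
  case 0
  let ?P = "run_law K (spike_instance M p j) A 0"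
  have P: "?P = run_law K (spike_instance M 0 j') A 0" by simp
  note sp = run_law_space[OF spike_instance_arm_measures[of M p j K] le0]
  have sets: "sets ?P = sets (R 0)" using sp by (simp add: space_subprob_algebra)
  interpret subprob_space ?P using sp by (simp add: space_subprob_algebra)
  have "(\<lambda>w. F (fst w, view 0 (snd w))) \<in> borel_measurable ?P"
    unfolding measurable_cong_sets[OF sets refl] by (rule measurable_compose[OF view_measurable 0(2)])
  \<comment> \<open>Before the first round the two laws coincide, and only the squared mean against
    the second moment remains.\<close>
  from Cauchy_Schwarz_nn_integral[OF this, of "\<lambda>_. 1"]
  have "(\<integral>\<^sup>+w. F (fst w, view 0 (snd w)) \<partial>?P)\<^sup>2
      \<le> (\<integral>\<^sup>+w. (F (fst w, view 0 (snd w)))\<^sup>2 \<partial>?P) * emeasure ?P (space ?P)" by simp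
  also have "\<dots> \<le> (\<integral>\<^sup>+w. (F (fst w, view 0 (snd w)))\<^sup>2 \<partial>?P) * 1"
    by (intro mult_left_mono emeasure_space_le_1) simp
  finally show ?case unfolding P by simp
next
  case (Suc t)
  then have t: "t < T" by simp
  let ?c = "1 + 9 * \<epsilon>\<^sup>2 * p\<^sup>2"
  let ?\<nu> = "spike_instance M p j" and ?base = "spike_instance M 0 j'"
  note \<nu> = spike_instance_arm_measures
  note F = Suc.prems(2,3)
  have F2: "(\<lambda>w. (F w)\<^sup>2) \<in> borel_measurable (U \<Otimes>\<^sub>M V (Suc t))" using F(1) by measurable
  have sets: "sets (run_law K ?base A t) = sets (R t)" using sets_run_law[OF \<nu>] t by simp
  have G: "(\<lambda>w. view_step t ?base (\<lambda>w. (F w)\<^sup>2) (fst w, view t (snd w))) \<in> borel_measurable (run_law K ?base A t)"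
    unfolding measurable_cong_sets[OF sets refl]
    by (rule measurable_compose[OF view_measurable view_step_measurable[OF t \<nu> F2]])
  have "(\<integral>\<^sup>+w. F (fst w, view (Suc t) (snd w)) \<partial>run_law K ?\<nu> A (Suc t))\<^sup>2 =
      (\<integral>\<^sup>+w. view_step t ?\<nu> F (fst w, view t (snd w)) \<partial>run_law K ?\<nu> A t)\<^sup>2"
    by (simp only: nn_integral_view_Suc[OF t \<nu> F(1)])
  also have "\<dots> \<le> ennreal (?c ^ t) * (\<integral>\<^sup>+w. (view_step t ?\<nu> F (fst w, view t (snd w)))\<^sup>2 \<partial>run_law K ?base A t)"
    using t view_step_chi_square(2)[OF t p _ F] by (intro Suc.IH view_step_measurable \<nu> F) auto
  also have "\<dots> \<le> ennreal (?c ^ t) * (\<integral>\<^sup>+w. ennreal ?c *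
      view_step t ?base (\<lambda>w. (F w)\<^sup>2) (fst w, view t (snd w)) \<partial>run_law K ?base A t)"
    using measurable_space[OF view_measurable]
    by (intro mult_left_mono nn_integral_mono view_step_chi_square(1) t p F)
      (auto simp: sets_eq_imp_space_eq[OF sets])
  also have "\<dots> = ennreal (?c ^ Suc t) *
      (\<integral>\<^sup>+w. view_step t ?base (\<lambda>w. (F w)\<^sup>2) (fst w, view t (snd w)) \<partial>run_law K ?base A t)"
  proof -
    have "ennreal (?c ^ Suc t) = ennreal (?c ^ t) * ennreal ?c"
      by (subst ennreal_mult[symmetric]) (auto simp: mult.commute)
    then show ?thesis by (simp only: nn_integral_cmult[OF G] mult.assoc)
  qed
  also have "\<dots> = ennreal (?c ^ Suc t) *
      (\<integral>\<^sup>+w. (F (fst w, view (Suc t) (snd w)))\<^sup>2 \<partial>run_law K ?base A (Suc t))"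
    by (simp only: nn_integral_view_Suc[OF t \<nu> F2])
  finally show ?case .
qed

text \<open>The arm is one with expected frequency of pulls at most \<open>1 / K\<close> when no arm pays. Since the
  frequency \<open>F\<close> lies in \<open>[0, 1]\<close>, \<open>F\<^sup>2 \<le> F\<close> and the chi-square bound gives \<open>9 / 10 > (3 / 2 \<cdot> 1 / 2)\<^sup>1\<^sup>/\<^sup>2\<close>.\<close>

lemma exists_rarely_pulled_arm:
  assumes "2 \<le> K" "1 \<le> T" and p: "0 \<le> p" "p \<le> 1"
    and T: "(1 + 9 * \<epsilon>\<^sup>2 * p\<^sup>2) ^ T \<le> 3 / 2"
  shows "\<exists>j<K. (\<integral>\<^sup>+w. (\<Sum>s<T. of_bool (fst (snd w s) = j)) \<partial>run_law K (spike_instance M p j) A T)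
    \<le> ennreal (9 / 10 * T)"
proof -
  define F :: "nat \<Rightarrow> 'u \<times> (nat \<Rightarrow> nat \<times> 'y) \<Rightarrow> ennreal"
    where "F j w = ennreal (1 / T) * (\<Sum>s<T. of_bool (fst (snd w s) = j))" for j w
  let ?P = "run_law K (spike_instance M 0 0) A T"
  define X where "X j = (\<integral>\<^sup>+w. F j (fst w, view T (snd w)) \<partial>?P)" for j
  have arm: "(\<lambda>w. fst (snd w s)) \<in> U \<Otimes>\<^sub>M V T \<rightarrow>\<^sub>M count_space {..<K}" if "s < T" for s
  proof -
    have "(\<lambda>w. snd w s) \<in> U \<Otimes>\<^sub>M V T \<rightarrow>\<^sub>M count_space {..<K} \<Otimes>\<^sub>M Y"
      unfolding view_space_def
      by (rule measurable_compose[OF measurable_snd measurable_component_singleton]) (simp add: that)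
    from measurable_compose[OF this measurable_fst] show ?thesis .
  qed
  have F: "F j \<in> borel_measurable (U \<Otimes>\<^sub>M V T)" for j
  proof -
    have "(\<lambda>w. of_bool (fst (snd w s) = j) :: ennreal) \<in> borel_measurable (U \<Otimes>\<^sub>M V T)" if "s < T" for s
      using measurable_compose[OF arm[OF that], of "\<lambda>a. of_bool (a = j)" borel] by simp
    then show ?thesis unfolding F_def[abs_def] by measurable
  qed
  have unit: "ennreal (1 / T) * of_nat T = 1"
    using \<open>1 \<le> T\<close> by (simp add: ennreal_of_nat_eq_real_of_nat ennreal_mult[symmetric])
  have F1: "F j w \<le> 1" for j w
  proof -
    have "F j w \<le> ennreal (1 / T) * (\<Sum>s<T. 1)"
      unfolding F_def by (intro mult_left_mono sum_mono) (auto simp: of_bool_def)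
    then show ?thesis by (simp add: unit)
  qed
  have sumF: "(\<Sum>j<K. F j w) = 1" if "w \<in> space (U \<Otimes>\<^sub>M V T)" for w
  proof -
    have "(\<Sum>j<K. of_bool (fst (snd w s) = j) :: ennreal) = 1" if "s < T" for s
      using measurable_space[OF arm[OF that] \<open>w \<in> _\<close>] by (simp add: of_bool_def)
    then have "(\<Sum>j<K. \<Sum>s<T. of_bool (fst (snd w s) = j) :: ennreal) = of_nat T"
      by (subst sum.swap) simp
    then show ?thesis by (simp add: F_def sum_distrib_left[symmetric] unit)
  qed
  note \<nu> = spike_instance_arm_measures
  have sets: "sets ?P = sets (R T)" using sets_run_law[OF \<nu>] by simp
  have G: "(\<lambda>w. F j (fst w, view T (snd w))) \<in> borel_measurable (run_law K (spike_instance M q i) A T)" for j q i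
    unfolding measurable_cong_sets[OF sets_run_law[OF \<nu> order_refl] refl]
    by (rule measurable_compose[OF view_measurable F])
  interpret P: subprob_space ?P using run_law_space[OF \<nu> order_refl] by (simp add: space_subprob_algebra)
  have "(\<Sum>j<K. X j) = (\<integral>\<^sup>+w. (\<Sum>j<K. F j (fst w, view T (snd w))) \<partial>?P)"
    unfolding X_def using G by (intro nn_integral_sum[symmetric]) auto
  also have "\<dots> = (\<integral>\<^sup>+w. 1 \<partial>?P)"
    using measurable_space[OF view_measurable] sets_eq_imp_space_eq[OF sets]
    by (intro nn_integral_cong sumF) auto
  also have "\<dots> \<le> 1" using P.emeasure_space_le_1 by simp
  finally have sumX: "(\<Sum>j<K. X j) \<le> 1" .
  have "finite (X ` {..<K})" "X ` {..<K} \<noteq> {}" using \<open>2 \<le> K\<close> by (auto simp: lessThan_empty_iff)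
  from Min_in[OF this] obtain j where j: "j < K" "X j = Min (X ` {..<K})" by auto
  \<comment> \<open>The frequencies sum to 1, so the least has mean at most \<open>1 / K\<close>.
    Only \<open>1 / 2\<close> is kept, which makes the constants independent of
    \<open>K\<close>.\<close>
  have "2 * X j \<le> of_nat K * X j" using \<open>2 \<le> K\<close> by (intro mult_right_mono) (auto simp: ennreal_of_nat_eq_real_of_nat numeral_le_ennreal_iff)
  also have "\<dots> \<le> (\<Sum>j<K. X j)"
    using sum_bounded_below[of "{..<K}" "X j" X] j by simp
  finally have X: "2 * X j \<le> 1" using sumX by simp
  define Z where "Z = (\<integral>\<^sup>+w. F j (fst w, view T (snd w)) \<partial>run_law K (spike_instance M p j) A T)"
  have "Z\<^sup>2 \<le> ennreal ((1 + 9 * \<epsilon>\<^sup>2 * p\<^sup>2) ^ T) * (\<integral>\<^sup>+w. (F j (fst w, view T (snd w)))\<^sup>2 \<partial>?P)"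
    unfolding Z_def by (intro run_law_chi_square p F F1) simp
  also have "\<dots> \<le> ennreal (3 / 2) * X j"
    unfolding X_def using F1 T
    by (intro mult_mono ennreal_leI nn_integral_mono) (auto simp: power2_eq_square intro: mult_left_le)
  finally have Z2: "Z\<^sup>2 \<le> ennreal (3 / 2) * X j" .
  have "X j \<noteq> top" using X by (auto simp: ennreal_mult_top top_unique)
  then obtain x where x: "X j = ennreal x" "0 \<le> x" by (cases "X j") auto
  have x2: "x \<le> 1 / 2" using X x by (simp add: ennreal_numeral[symmetric] ennreal_mult[symmetric] del: ennreal_numeral)
  note Z2
  also have "ennreal (3 / 2) * X j = ennreal (3 / 2 * x)" by (subst ennreal_mult) (auto simp: x)
  also have "\<dots> \<le> ennreal (3 / 4)" using x2 by (intro ennreal_leI) simp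
  finally have Z2': "Z\<^sup>2 \<le> ennreal (3 / 4)" .
  have Z: "Z \<le> ennreal (9 / 10)"
  proof (rule ccontr)
    assume "\<not> Z \<le> ennreal (9 / 10)"
    then have "(ennreal (9 / 10))\<^sup>2 \<le> Z\<^sup>2" by (intro power_mono) auto
    from order_trans[OF this Z2'] have "ennreal ((9 / 10)\<^sup>2) \<le> ennreal (3 / 4)"
      by (subst ennreal_power[symmetric]) auto
    then show False by (simp add: power2_eq_square)
  qed
  have view: "fst (view T r s) = fst (r s)" if "s < T" for r :: "nat \<Rightarrow> nat \<times> real \<times> 'y" and s
    using that by (simp add: view_def)
  have "of_nat T * F j (fst w, view T (snd w)) = (\<Sum>s<T. of_bool (fst (snd w s) = j))" for w :: "('u, 'y) run"
  proof -
    have "of_nat T * F j (fst w, view T (snd w)) = (\<Sum>s<T. of_bool (fst (view T (snd w) s) = j))"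
      unfolding F_def by (simp only: mult.assoc[symmetric] mult.commute[of "of_nat T"] unit mult_1 snd_conv)
    also have "\<dots> = (\<Sum>s<T. of_bool (fst (snd w s) = j))"
      by (intro sum.cong refl) (simp only: lessThan_iff view)
    finally show ?thesis .
  qed
  then have "(\<integral>\<^sup>+w. (\<Sum>s<T. of_bool (fst (snd w s) = j)) \<partial>run_law K (spike_instance M p j) A T) =
      (\<integral>\<^sup>+w. of_nat T * F j (fst w, view T (snd w)) \<partial>run_law K (spike_instance M p j) A T)"
    by (simp only:)
  also have "\<dots> = of_nat T * Z" unfolding Z_def by (rule nn_integral_cmult[OF G])
  also have "\<dots> \<le> of_nat T * ennreal (9 / 10)" using Z by (intro mult_left_mono) auto
  also have "\<dots> = ennreal (9 / 10 * T)" by (simp add: ennreal_of_nat_eq_real_of_nat ennreal_mult[symmetric] mult.commute)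
  finally show ?thesis using j(1) by blast
qed

text \<open>The rarely pulled arm is made the paying one. The best mean is at least
  \<open>M * p\<close>, while the learner collects at most nine tenths of
  \<open>M * p * T\<close>.\<close>

lemma spike_instance_regret:
  assumes "2 \<le> K" "1 \<le> T" and p: "0 \<le> p" "p \<le> 1" and M: "0 \<le> M"
    and T: "(1 + 9 * \<epsilon>\<^sup>2 * p\<^sup>2) ^ T \<le> 3 / 2"
  shows "\<exists>j. regret K (spike_instance M p j) T A \<ge> 1 / 10 * (M * p) * T"
proof -
  obtain j where j: "j < K"
    "(\<integral>\<^sup>+w. (\<Sum>s<T. of_bool (fst (snd w s) = j)) \<partial>run_law K (spike_instance M p j) A T) \<le> ennreal (9 / 10 * T)"
    using exists_rarely_pulled_arm[OF assms(1,2) p T] by blast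
  let ?P = "run_law K (spike_instance M p j) A T"
  note \<nu> = spike_instance_arm_measures
  \<comment> \<open>Runs with negative rewards belong to the space, so the sum is compared with the
    sum of the positive parts.\<close>
  have "(\<integral>\<^sup>+w. ennreal (\<Sum>s<T. fst (snd (snd w s))) \<partial>?P) \<le> (\<integral>\<^sup>+w. (\<Sum>s<T. ennreal (fst (snd (snd w s)))) \<partial>?P)"
  proof (intro nn_integral_mono)
    fix w :: "('u, 'y) run"
    have "ennreal (\<Sum>s<T. fst (snd (snd w s))) \<le> ennreal (\<Sum>s<T. max 0 (fst (snd (snd w s))))"
      by (intro ennreal_leI sum_mono) simp
    also have "\<dots> = (\<Sum>s<T. ennreal (fst (snd (snd w s))))"
      by (subst sum_ennreal[symmetric], simp) (intro sum.cong refl, simp add: max_def ennreal_neg)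
    finally show "ennreal (\<Sum>s<T. fst (snd (snd w s))) \<le> (\<Sum>s<T. ennreal (fst (snd (snd w s))))" .
  qed
  also have "\<dots> = (\<integral>\<^sup>+w. ennreal (M * p) * (\<Sum>s<T. of_bool (fst (snd w s) = j)) \<partial>?P)"
    by (simp only: pulls_eq_rewards[OF p M order_refl] sum_distrib_left)
  also have "\<dots> = ennreal (M * p) * (\<integral>\<^sup>+w. (\<Sum>s<T. of_bool (fst (snd w s) = j)) \<partial>?P)"
  proof (rule nn_integral_cmult)
    have "(\<lambda>w. of_bool (fst (snd w s) = j) :: ennreal) \<in> borel_measurable (R T)" if "s < T" for s
      using pulled_measurable[OF that] .
    then show "(\<lambda>w. \<Sum>s<T. of_bool (fst (snd w s) = j) :: ennreal) \<in> borel_measurable ?P"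
      unfolding measurable_cong_sets[OF sets_run_law[OF \<nu> order_refl] refl] by measurable
  qed
  also have "\<dots> \<le> ennreal (M * p) * ennreal (9 / 10 * T)" using j(2) by (intro mult_left_mono) auto
  also have "\<dots> = ennreal (9 / 10 * (M * p) * T)" using p M by (simp add: ennreal_mult[symmetric] ac_simps)
  \<comment> \<open>As the bound is nonnegative, this passage to the real integral also covers the
    default value 0 of a non-integrable function.\<close>
  finally have "(\<integral>w. (\<Sum>s<T. fst (snd (snd w s))) \<partial>?P) \<le> 9 / 10 * (M * p) * T"
    using p M by (intro integral_real_bounded) auto
  moreover have "M * p \<le> best_mean K (spike_instance M p j)"
  proof -
    have "arm_mean (spike_instance M p j j) = M * p"
      by (simp add: spike_instance_def arm_mean_spike_arm p)
    then have "M * p \<in> (\<lambda>a. arm_mean (spike_instance M p j a)) ` {..<K}" using j(1) by (metis imageI lessThan_iff)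
    then show ?thesis unfolding best_mean_def by (intro Max_ge) auto
  qed
  then have "real T * (M * p) \<le> real T * best_mean K (spike_instance M p j)" by (intro mult_left_mono) auto
  ultimately have "1 / 10 * (M * p) * T \<le> regret K (spike_instance M p j) T A"
    by (simp add: regret_def case_prod_unfold algebra_simps)
  then show ?thesis by blast
qed

end

section \<open>Choice of the spike and the resulting rate\<close>

lemma one_plus_power_le:
  fixes x :: real
  assumes "0 \<le> x" "real n * x \<le> 1 / 4"
  shows "(1 + x) ^ n \<le> 3 / 2"
proof -
  have "(1 + x) ^ n \<le> exp x ^ n" using assms by (intro power_mono exp_ge_add_one_self) auto
  also have "\<dots> = exp (real n * x)" by (simp add: exp_of_nat_mult)
  also have "\<dots> \<le> exp (1 / 4)" using assms by simp
  also have "\<dots> \<le> 1 + 1 / 4 + (1 / 4)\<^sup>2" by (rule exp_bound) auto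
  also have "\<dots> \<le> 3 / 2" by (simp add: power2_eq_square)
  finally show ?thesis .
qed

text \<open>The instance is chosen after the learner and the horizon: \<open>p\<close> and
  \<open>M\<close> depend on \<open>T\<close>, and the paying arm on \<open>A\<close>. A learner
  that always pulls the best arm of a fixed instance would have no regret there. The constant is
  \<open>1 / 10\<close> for every \<open>v\<close>.\<close>

theorem theorem9:
  fixes v :: real
  assumes "0 < v" and "v \<le> 1"
  shows "\<exists>c>0. \<forall>K\<ge>2. \<forall>\<epsilon>\<in>{0<..1}. \<exists>T\<^sub>0. \<forall>T\<ge>T\<^sub>0.
    \<forall>A :: ('u, 'y) bandit_algorithm. ldp_algorithm \<epsilon> K T A \<longrightarrow>
      (\<exists>\<nu>. heavy_tailed_instance K v \<nu> \<and>
        regret K \<nu> T A \<ge> c * (real K / \<epsilon>\<^sup>2) powr (v / (1 + v)) * real T powr (1 / (1 + v)))"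
proof (intro exI[of _ "1 / 10 :: real"] conjI allI impI ballI)
  fix K :: nat and \<epsilon> :: real
  assume K: "2 \<le> K" and "\<epsilon> \<in> {0<..1}"
  then have \<epsilon>: "0 < \<epsilon>" "\<epsilon> \<le> 1" by auto
  \<comment> \<open>This is the condition
    \<open>T * (9 * \<epsilon>\<^sup>2 * p\<^sup>2) \<le> 1 / 4\<close> solved for \<open>T\<close>,
    with the \<open>p\<close> chosen below.\<close>
  define T0 where "T0 = nat \<lceil>36 * (real K)\<^sup>2 / \<epsilon>\<^sup>2\<rceil>"
  have "\<exists>\<nu>. heavy_tailed_instance K v \<nu> \<and>
        regret K \<nu> T A \<ge> 1 / 10 * (real K / \<epsilon>\<^sup>2) powr (v / (1 + v)) * real T powr (1 / (1 + v))"
    if "T0 \<le> T" and ldp: "ldp_algorithm \<epsilon> K T A" for T and A :: "('u, 'y) bandit_algorithm"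
  proof -
    interpret private_bandit_run \<epsilon> K T A using ldp \<epsilon> by unfold_locales auto
    \<comment> \<open>The target rate dictates \<open>p\<close>, since the gap \<open>M * p\<close>
      equals \<open>p powr (v / (1 + v))\<close>. The value of \<open>M\<close> normalises the
      moment to exactly 1.\<close>
    define p where "p = real K / (real T * \<epsilon>\<^sup>2)"
    define M where "M = p powr (- 1 / (1 + v))"
    have "36 * (real K)\<^sup>2 / \<epsilon>\<^sup>2 \<le> T" using that(1) unfolding T0_def by linarith
    then have T: "36 * (real K)\<^sup>2 \<le> T * \<epsilon>\<^sup>2" using \<epsilon> by (simp add: field_simps)
    \<comment> \<open>The same threshold ensures that \<open>p\<close> is a probability.\<close>
    have "1 * real K \<le> 36 * real K * real K" using K by (intro mult_right_mono) auto
    then have KT: "real K \<le> T * \<epsilon>\<^sup>2" using T by (simp add: power2_eq_square)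
    then have T1: "1 \<le> T" using K by (cases T) auto
    then have p: "0 < p" "p \<le> 1" using K KT \<epsilon> by (auto simp: p_def)
    have "real T * (9 * \<epsilon>\<^sup>2 * p\<^sup>2) = 9 * (real K)\<^sup>2 / (T * \<epsilon>\<^sup>2)"
      using T1 \<epsilon> by (simp add: p_def field_simps power2_eq_square)
    also have "\<dots> \<le> 1 / 4" using T T1 \<epsilon> by (simp add: field_simps)
    finally have "(1 + 9 * \<epsilon>\<^sup>2 * p\<^sup>2) ^ T \<le> 3 / 2" by (intro one_plus_power_le) auto
    then obtain j where j: "regret K (spike_instance M p j) T A \<ge> 1 / 10 * (M * p) * T"
      using spike_instance_regret[of p M] K T1 p by (auto simp: M_def)
    have v: "1 + v \<noteq> 0" "v / (1 + v) = 1 - 1 / (1 + v)" using assms by (auto simp: field_simps)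
    have "\<bar>M\<bar> powr (1 + v) * p = p powr (- 1) * p" using v(1) by (simp add: M_def powr_powr)
    also have "\<dots> = 1" using p by (simp add: powr_minus)
    finally have "heavy_tailed_instance K v (spike_instance M p j)"
      using p by (intro heavy_tailed_spike_instance) auto
    moreover have "M * p * T = (real K / \<epsilon>\<^sup>2) powr (v / (1 + v)) * real T powr (1 / (1 + v))"
    proof -
      have "M * p = p powr (v / (1 + v))"
        using p by (simp add: M_def v(2) powr_diff powr_minus field_simps)
      also have "\<dots> = (real K / \<epsilon>\<^sup>2 / real T) powr (v / (1 + v))"
        by (simp add: p_def mult.commute)
      also have "\<dots> =
          (real K / \<epsilon>\<^sup>2) powr (v / (1 + v)) / real T powr (v / (1 + v))"
        by (rule powr_divide)
      also have "real T powr (v / (1 + v)) = real T / real T powr (1 / (1 + v))"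
        using T1 by (simp add: v(2) powr_diff)
      finally show ?thesis using T1 by simp
    qed
    ultimately show ?thesis using j by (intro exI[of _ "spike_instance M p j"]) (auto simp: mult.assoc)
  qed
  then show "\<exists>T\<^sub>0. \<forall>T\<ge>T\<^sub>0. \<forall>A :: ('u, 'y) bandit_algorithm. ldp_algorithm \<epsilon> K T A \<longrightarrow>
      (\<exists>\<nu>. heavy_tailed_instance K v \<nu> \<and>
        regret K \<nu> T A \<ge> 1 / 10 * (real K / \<epsilon>\<^sup>2) powr (v / (1 + v)) * real T powr (1 / (1 + v)))"
    by blast
qed simp

end
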